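(* Consider the semi-discrete scheme described in the context. Suppose the solution is in equilibrium at all Gauss–Lobatto points $\{x_j,x_{j+\frac12},x_{j+1}\}$ of every cell $K_{j+\frac12}$, namely, the discrete data $\{\boldsymbol U_j,\boldsymbol U_{j+\frac12},\boldsymbol U_{j+1}\}$ satisfy $$q_j=q_{j+\frac12}=q_{j+1}\equiv\widehat q=\mathrm{Const},\qquad E_j=E_{j+\frac12}=E_{j+1}\equiv\widehat E=\mathrm{Const},\qquad \forall K_{j+\frac12}.$$ Then the scheme is well-balanced, in the sense that the right-hand sides of the evolution equations for the cell averages and for the point values all vanish, i.e. $$\frac{\mathrm d}{\mathrm dt}\,\overline{\boldsymbol U}_{j+\frac12}=\boldsymbol 0\qquad\text{and}\qquad \frac{\mathrm d}{\mathrm dt}\,\boldsymbol V_j=\boldsymbol 0 .$$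
   Context: The scheme discretizes the one-dimensional shallow water (Saint-Venant) system with bottom topography $Z(x)$ and Manning friction coefficient $n$; $g$ is the constant gravity acceleration, $h\ge0$ the water depth, $u$ the velocity, $q=hu$ the discharge. The smooth steady states of the system are $q\equiv\mathrm{Const}$, $E:=\frac{u^2}{2}+g(h+Z+Q)\equiv\mathrm{Const}$, where $Q=\int_{\widehat x}^x n^2h^{-10/3}|q|q\,\mathrm d\xi$. **Mesh and unknowns.** Uniform cells $K_{j+\frac12}=[x_j,x_{j+1}]$ of size $\Delta x$ with centers $x_{j+\frac12}$; $Z_j=Z(x_j)$, $Z_{j+\frac12}=Z(x_{j+\frac12})$. The unknowns at time $t$ are the cell averages $\overline{\boldsymbol U}_{j+\frac12}$ of $\boldsymbol U=(h,q)^\top$ and the point values $\boldsymbol V_j=(h_j,u_j)^\top$ at $x_j$. **Point values.** At mesh points $q_j:=h_ju_j$ and $\boldsymbol U_j=(h_j,q_j)^\top$. At cell centers and quarter points, $$\boldsymbol U_{j+\frac12}=(h_{j+\frac12},q_{j+\frac12})^\top:=\tfrac32\overline{\boldsymbol U}_{j+\frac12}-\tfrac14(\boldsymbol U_j+\boldsymbol U_{j+1}),$$ $$\boldsymbol U_{j+\frac14}=(h_{j+\frac14},q_{j+\frac14})^\top:=\tfrac{3}{16}\boldsymbol U_j+\tfrac{18}{16}\overline{\boldsymbol U}_{j+\frac12}-\tfrac{5}{16}\boldsymbol U_{j+1}.$$ The center velocity is $u_{j+\frac12}:=\mathfrak D(q_{j+\frac12},h_{j+\frac12})$, where the desingularization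 function is $\mathfrak D(a,b)=a/b$ if $b\ge\varepsilon$ and $\mathfrak D(a,b)=0$ otherwise, with a small parameter $\varepsilon>0$. **Friction quantity.** $Q_1=0$ and $$Q_{j+\frac12}=Q_j+\frac{n^2\Delta x}{12}\Big(\frac{|q_j|q_j}{h_j^{10/3}}+\frac{|q_{j+\frac12}|q_{j+\frac12}}{h_{j+\frac12}^{10/3}}+4\frac{|q_{j+\frac14}|q_{j+\frac14}}{h_{j+\frac14}^{10/3}}\Big),$$ $$Q_{j+1}=Q_j+\frac{n^2\Delta x}{6}\Big(\frac{|q_j|q_j}{h_j^{10/3}}+\frac{|q_{j+1}|q_{j+1}}{h_{j+1}^{10/3}}+4\frac{|q_{j+\frac12}|q_{j+\frac12}}{h_{j+\frac12}^{10/3}}\Big).$$ **Equilibrium variables.** For $i=j$ and $i=j+\frac12$: $E_i=\frac{u_i^2}{2}+g(h_i+Z_i+Q_i)$ and $\boldsymbol E_i=(q_i,E_i)^\top$. **Point-value evolution.** $\frac{\mathrm d}{\mathrm dt}\boldsymbol V_j=-\big(\overleftarrow{\Phi}_{j+\frac12}+\overrightarrow{\Phi}_{j-\frac12}\big)$ with $$\overleftarrow{\Phi}_{j+\frac12}=\widetilde J_j^-\,\delta_j^-\boldsymbol E,\qquad \overrightarrow{\Phi}_{j-\frac12}=\widetilde J_j^+\,\delta_j^+\boldsymbol E,$$ $$\delta_j^+\boldsymbol E=\frac1{\Delta x}(\boldsymbol E_{j-1}-4\boldsymbol E_{j-\frac12}+3\boldsymbol E_j),\qquad \delta_j^-\boldsymbol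 E=\frac1{\Delta x}(-3\boldsymbol E_j+4\boldsymbol E_{j+\frac12}-\boldsymbol E_{j+1}),$$ $$\widetilde J_j^\pm=\Upsilon_j\,\mathrm{diag}\Big(\frac{\lambda_1^\pm}{\lambda_1},\frac{\lambda_2^\pm}{\lambda_2}\Big)\Upsilon_j^{-1},\qquad \Upsilon_j=\begin{pmatrix}-\sqrt{h_j/g}&\sqrt{h_j/g}\\1&1\end{pmatrix},$$ where $\lambda_{1,2}=u_j\mp\sqrt{gh_j}$, $\lambda^\pm$ denote positive and negative parts, and a Harten–Yee entropy fix is used in the diagonal matrix for small eigenvalues. **Cell-average evolution.** $\frac{\mathrm d}{\mathrm dt}\overline{\boldsymbol U}_{j+\frac12}=-\frac{\boldsymbol{\mathcal F}_{j+1}-\boldsymbol{\mathcal F}_j}{\Delta x}+\overline{\boldsymbol S}_{j+\frac12}$ with $$\boldsymbol{\mathcal F}_j=\begin{pmatrix}q_j\\ h_ju_j^2+\frac g2h_j^2\end{pmatrix},\qquad \overline{\boldsymbol S}_{j+\frac12}=\begin{pmatrix}0\\ \overline S^{(2)}_{j+\frac12}\end{pmatrix},\qquad \overline S^{(2)}_{j+\frac12}=\frac{4S_2-S_1}{3\Delta x},$$ $$S_1=-g\,\overline{\overline h}_{j,j+1}[Z+Q]_{j,j+1}+\widehat s_{j,j+1},$$ $$S_2=-g\,\overline{\overline h}_{j,j+\frac12}[Z+Q]_{j,j+\frac12}+\widehat s_{j,j+\frac12}-g\,\overline{\overline h}_{j+\frac12,j+1}[Z+Q]_{j+\frac12,j+1}+\widehat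 s_{j+\frac12,j+1},$$ where $\overline{\overline h}_{a,b}=\frac12(h_a+h_b)$, $[w]_{a,b}=w_b-w_a$ for any quantity $w$, and $$\widehat s_{a,b}=\frac{\Gamma_{a,b}}4\,[h]_{a,b}\big([u]_{a,b}\big)^2,\qquad \Gamma_{a,b}=\frac1{1+(C\,\|\boldsymbol E_b-\boldsymbol E_a\|)^m},$$ with positive constants $C$ and $m$ ($C=2$, $m=10$ in the computations).
   Formalization: Added assumption: if q̂ ≠ 0, then h_{j+1/2} ≥ ε in every cell, so the desingularization is inactive at cell centers in moving water; without it u_{j+1/2} = 0 while q_{j+1/2} = q̂ ≠ 0, and the cell-average right-hand side need not vanish. *)

theory Defs
  imports "HOL-Analysis.Analysis"
begin

text \<open>
  Parameters of the scheme. The node \<open>x\<^sub>j\<close> and the cell \<open>K\<^sub>j\<^sub>+\<^sub>1\<^sub>/\<^sub>2 = [x\<^sub>j, x\<^sub>j\<^sub>+\<^sub>1]\<close> both carry the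
  integer index \<open>j\<close>. The fields \<open>ratio_pos\<close> and \<open>ratio_neg\<close> are the entropy-fixed versions of
  \<open>\<lambda> \<mapsto> \<lambda>\<^sup>+/\<lambda>\<close> and \<open>\<lambda> \<mapsto> \<lambda>\<^sup>-/\<lambda>\<close>; see \<open>entropy_fix\<close> below.
\<close>

record sw_scheme =
  grav :: real                     (* gravity g *)
  manning :: real                  (* friction coefficient n *)
  topo :: "real \<Rightarrow> real"          (* bottom topography Z *)
  x_first :: real                  (* position of the node with index 1 *)
  dx :: real                       (* cell size *)
  desing_eps :: real               (* desingularization threshold *)
  gam_C :: real                    (* constant C in Gamma *)
  gam_m :: real                    (* exponent m in Gamma *)
  fix_thr :: real                  (* size below which eigenvalues count as small *)
  ratio_pos :: "real \<Rightarrow> real"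
  ratio_neg :: "real \<Rightarrow> real"

text \<open>
  An entropy fix alters the ratios \<open>\<lambda>\<^sup>\<plusminus>/\<lambda>\<close> only for eigenvalues with \<open>\<bar>\<lambda>\<bar> < \<delta>\<close>. No particular
  values are prescribed there, since the ratio is singular at \<open>\<lambda> = 0\<close> and its implementation
  varies; the Harten--Yee function is an instance (lemma \<open>entropy_fix_harten_yee\<close>).
\<close>

definition entropy_fix :: "real \<Rightarrow> (real \<Rightarrow> real) \<Rightarrow> (real \<Rightarrow> real) \<Rightarrow> bool" where
  "entropy_fix \<delta> rp rn \<longleftrightarrow>
     (\<forall>l. \<delta> \<le> \<bar>l\<bar> \<longrightarrow> rp l = max l 0 / l \<and> rn l = min l 0 / l)"

definition harten_yee :: "real \<Rightarrow> real \<Rightarrow> real" where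
  "harten_yee \<delta> l = (if \<delta> \<le> \<bar>l\<bar> then \<bar>l\<bar> else (l\<^sup>2 + \<delta>\<^sup>2) / (2 * \<delta>))"

lemma entropy_fix_harten_yee:
  "entropy_fix \<delta> (\<lambda>l. (l + harten_yee \<delta> l) / 2 / l) (\<lambda>l. (l - harten_yee \<delta> l) / 2 / l)"
  by (auto simp: entropy_fix_def harten_yee_def max_def min_def abs_if)

definition valid_scheme :: "sw_scheme \<Rightarrow> bool" where
  "valid_scheme P \<longleftrightarrow>
     0 < grav P \<and> 0 < dx P \<and> 0 < desing_eps P \<and> 0 < gam_C P \<and> 0 < gam_m P \<and>
     0 < fix_thr P \<and> entropy_fix (fix_thr P) (ratio_pos P) (ratio_neg P)"

definition desing :: "real \<Rightarrow> real \<Rightarrow> real \<Rightarrow> real" where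
  "desing \<epsilon> a b = (if \<epsilon> \<le> b then a / b else 0)"

text \<open>
  \<open>Node j\<close> is \<open>x\<^sub>j\<close> and \<open>Center j\<close> is \<open>x\<^sub>j\<^sub>+\<^sub>1\<^sub>/\<^sub>2\<close>. A discrete state consists of the cell averages
  \<open>Ubar j\<close> of \<open>(h, q)\<close> over \<open>K\<^sub>j\<^sub>+\<^sub>1\<^sub>/\<^sub>2\<close> and the point values \<open>V j = (h\<^sub>j, u\<^sub>j)\<close>.
\<close>

datatype gl_point = Node int | Center int

type_synonym grid_vec = "int \<Rightarrow> real^2"

definition U_node :: "grid_vec \<Rightarrow> int \<Rightarrow> real^2" where
  "U_node V j = vector [V j $ 1, V j $ 1 * V j $ 2]"

definition U_quarter :: "grid_vec \<Rightarrow> grid_vec \<Rightarrow> int \<Rightarrow> real^2" where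
  "U_quarter Ubar V j =
     (3/16) *\<^sub>R U_node V j + (18/16) *\<^sub>R Ubar j - (5/16) *\<^sub>R U_node V (j + 1)"

fun U_at :: "grid_vec \<Rightarrow> grid_vec \<Rightarrow> gl_point \<Rightarrow> real^2" where
  "U_at Ubar V (Node j) = U_node V j"
| "U_at Ubar V (Center j) = (3/2) *\<^sub>R Ubar j - (1/4) *\<^sub>R (U_node V j + U_node V (j + 1))"

definition h_at :: "grid_vec \<Rightarrow> grid_vec \<Rightarrow> gl_point \<Rightarrow> real" where
  "h_at Ubar V p = U_at Ubar V p $ 1"

definition q_at :: "grid_vec \<Rightarrow> grid_vec \<Rightarrow> gl_point \<Rightarrow> real" where
  "q_at Ubar V p = U_at Ubar V p $ 2"

fun u_at :: "sw_scheme \<Rightarrow> grid_vec \<Rightarrow> grid_vec \<Rightarrow> gl_point \<Rightarrow> real" where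
  "u_at P Ubar V (Node j) = V j $ 2"
| "u_at P Ubar V (Center j) =
     desing (desing_eps P) (q_at Ubar V (Center j)) (h_at Ubar V (Center j))"

fun x_at :: "sw_scheme \<Rightarrow> gl_point \<Rightarrow> real" where
  "x_at P (Node j) = x_first P + of_int (j - 1) * dx P"
| "x_at P (Center j) = x_first P + of_int (j - 1) * dx P + dx P / 2"

definition Z_at :: "sw_scheme \<Rightarrow> gl_point \<Rightarrow> real" where
  "Z_at P p = topo P (x_at P p)"

text \<open>
  The friction integrand \<open>\<bar>q\<bar>q/h\<^sup>1\<^sup>0\<^sup>/\<^sup>3\<close>; division by zero in HOL makes it \<open>0\<close> where \<open>h = 0\<close>.
\<close>

definition fric :: "real^2 \<Rightarrow> real" where
  "fric U = \<bar>U $ 2\<bar> * U $ 2 / (U $ 1) powr (10/3)"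

definition Q_incr :: "sw_scheme \<Rightarrow> grid_vec \<Rightarrow> grid_vec \<Rightarrow> int \<Rightarrow> real" where
  "Q_incr P Ubar V j = (manning P)\<^sup>2 * dx P / 6 *
     (fric (U_at Ubar V (Node j)) + fric (U_at Ubar V (Node (j + 1)))
      + 4 * fric (U_at Ubar V (Center j)))"

text \<open>
  The closed form of the recursion \<open>Q\<^sub>1 = 0\<close>, \<open>Q\<^sub>j\<^sub>+\<^sub>1 = Q\<^sub>j + Q_incr j\<close>, run in both directions from
  the node with index 1; see the lemmas \<open>Q_node_first\<close> and \<open>Q_node_succ\<close>.
\<close>

definition Q_node :: "sw_scheme \<Rightarrow> grid_vec \<Rightarrow> grid_vec \<Rightarrow> int \<Rightarrow> real" where
  "Q_node P Ubar V j =
     (if 1 \<le> j then (\<Sum>k\<in>{1..<j}. Q_incr P Ubar V k) else - (\<Sum>k\<in>{j..<1}. Q_incr P Ubar V k))"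

lemma Q_node_first: "Q_node P Ubar V 1 = 0"
  by (simp add: Q_node_def)

lemma Q_node_succ: "Q_node P Ubar V (j + 1) = Q_node P Ubar V j + Q_incr P Ubar V j"
proof (cases "1 \<le> j")
  case True
  then have "{1..<j + 1} = insert j {1..<j}" by auto
  with True show ?thesis by (simp add: Q_node_def)
next
  case False
  then have "{j..<1} = insert j {j + 1..<1}" by auto
  with False show ?thesis by (cases "j = 0") (simp_all add: Q_node_def)
qed

fun Q_at :: "sw_scheme \<Rightarrow> grid_vec \<Rightarrow> grid_vec \<Rightarrow> gl_point \<Rightarrow> real" where
  "Q_at P Ubar V (Node j) = Q_node P Ubar V j"
| "Q_at P Ubar V (Center j) = Q_node P Ubar V j + (manning P)\<^sup>2 * dx P / 12 *
     (fric (U_at Ubar V (Node j)) + fric (U_at Ubar V (Center j))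
      + 4 * fric (U_quarter Ubar V j))"

definition E_at :: "sw_scheme \<Rightarrow> grid_vec \<Rightarrow> grid_vec \<Rightarrow> gl_point \<Rightarrow> real" where
  "E_at P Ubar V p =
     (u_at P Ubar V p)\<^sup>2 / 2 + grav P * (h_at Ubar V p + Z_at P p + Q_at P Ubar V p)"

definition Evec :: "sw_scheme \<Rightarrow> grid_vec \<Rightarrow> grid_vec \<Rightarrow> gl_point \<Rightarrow> real^2" where
  "Evec P Ubar V p = vector [q_at Ubar V p, E_at P Ubar V p]"

subsection \<open>Evolution of the point values\<close>

definition delta_plus :: "sw_scheme \<Rightarrow> grid_vec \<Rightarrow> grid_vec \<Rightarrow> int \<Rightarrow> real^2" where
  "delta_plus P Ubar V j = (1 / dx P) *\<^sub>R
     (Evec P Ubar V (Node (j - 1)) - 4 *\<^sub>R Evec P Ubar V (Center (j - 1))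
      + 3 *\<^sub>R Evec P Ubar V (Node j))"

definition delta_minus :: "sw_scheme \<Rightarrow> grid_vec \<Rightarrow> grid_vec \<Rightarrow> int \<Rightarrow> real^2" where
  "delta_minus P Ubar V j = (1 / dx P) *\<^sub>R
     (- (3 *\<^sub>R Evec P Ubar V (Node j)) + 4 *\<^sub>R Evec P Ubar V (Center j)
      - Evec P Ubar V (Node (j + 1)))"

definition Upsilon :: "sw_scheme \<Rightarrow> grid_vec \<Rightarrow> int \<Rightarrow> real^2^2" where
  "Upsilon P V j =
     vector [vector [- sqrt (V j $ 1 / grav P), sqrt (V j $ 1 / grav P)], vector [1, 1]]"

definition lambda1 :: "sw_scheme \<Rightarrow> grid_vec \<Rightarrow> int \<Rightarrow> real" where
  "lambda1 P V j = V j $ 2 - sqrt (grav P * V j $ 1)"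

definition lambda2 :: "sw_scheme \<Rightarrow> grid_vec \<Rightarrow> int \<Rightarrow> real" where
  "lambda2 P V j = V j $ 2 + sqrt (grav P * V j $ 1)"

definition J_tilde :: "(real \<Rightarrow> real) \<Rightarrow> sw_scheme \<Rightarrow> grid_vec \<Rightarrow> int \<Rightarrow> real^2^2" where
  "J_tilde r P V j =
     Upsilon P V j
     ** vector [vector [r (lambda1 P V j), 0], vector [0, r (lambda2 P V j)]]
     ** matrix_inv (Upsilon P V j)"

text \<open>\<open>Phi_left j\<close> belongs to \<open>x\<^sub>j\<^sub>+\<^sub>1\<^sub>/\<^sub>2\<close> and \<open>Phi_right j\<close> to \<open>x\<^sub>j\<^sub>-\<^sub>1\<^sub>/\<^sub>2\<close>; both act on the node \<open>x\<^sub>j\<close>.\<close>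

definition Phi_left :: "sw_scheme \<Rightarrow> grid_vec \<Rightarrow> grid_vec \<Rightarrow> int \<Rightarrow> real^2" where
  "Phi_left P Ubar V j = J_tilde (ratio_neg P) P V j *v delta_minus P Ubar V j"

definition Phi_right :: "sw_scheme \<Rightarrow> grid_vec \<Rightarrow> grid_vec \<Rightarrow> int \<Rightarrow> real^2" where
  "Phi_right P Ubar V j = J_tilde (ratio_pos P) P V j *v delta_plus P Ubar V j"

definition point_rhs :: "sw_scheme \<Rightarrow> grid_vec \<Rightarrow> grid_vec \<Rightarrow> int \<Rightarrow> real^2" where
  "point_rhs P Ubar V j = - (Phi_left P Ubar V j + Phi_right P Ubar V j)"

subsection \<open>Evolution of the cell averages\<close>

definition flux :: "sw_scheme \<Rightarrow> grid_vec \<Rightarrow> int \<Rightarrow> real^2" where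
  "flux P V j =
     vector [U_node V j $ 2, V j $ 1 * (V j $ 2)\<^sup>2 + grav P / 2 * (V j $ 1)\<^sup>2]"

definition Gam :: "sw_scheme \<Rightarrow> grid_vec \<Rightarrow> grid_vec \<Rightarrow> gl_point \<Rightarrow> gl_point \<Rightarrow> real" where
  "Gam P Ubar V a b =
     1 / (1 + (gam_C P * norm (Evec P Ubar V b - Evec P Ubar V a)) powr gam_m P)"

definition s_hat :: "sw_scheme \<Rightarrow> grid_vec \<Rightarrow> grid_vec \<Rightarrow> gl_point \<Rightarrow> gl_point \<Rightarrow> real" where
  "s_hat P Ubar V a b = Gam P Ubar V a b / 4 *
     (h_at Ubar V b - h_at Ubar V a) * (u_at P Ubar V b - u_at P Ubar V a)\<^sup>2"

text \<open>The contribution \<open>-g hbar [Z + Q] + s_hat\<close> of the subinterval between \<open>a\<close> and \<open>b\<close>.\<close>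

definition S_part :: "sw_scheme \<Rightarrow> grid_vec \<Rightarrow> grid_vec \<Rightarrow> gl_point \<Rightarrow> gl_point \<Rightarrow> real" where
  "S_part P Ubar V a b =
     - grav P * ((h_at Ubar V a + h_at Ubar V b) / 2)
       * ((Z_at P b + Q_at P Ubar V b) - (Z_at P a + Q_at P Ubar V a))
     + s_hat P Ubar V a b"

definition S1 :: "sw_scheme \<Rightarrow> grid_vec \<Rightarrow> grid_vec \<Rightarrow> int \<Rightarrow> real" where
  "S1 P Ubar V j = S_part P Ubar V (Node j) (Node (j + 1))"

definition S2 :: "sw_scheme \<Rightarrow> grid_vec \<Rightarrow> grid_vec \<Rightarrow> int \<Rightarrow> real" where
  "S2 P Ubar V j =
     S_part P Ubar V (Node j) (Center j) + S_part P Ubar V (Center j) (Node (j + 1))"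

definition source :: "sw_scheme \<Rightarrow> grid_vec \<Rightarrow> grid_vec \<Rightarrow> int \<Rightarrow> real^2" where
  "source P Ubar V j = vector [0, (4 * S2 P Ubar V j - S1 P Ubar V j) / (3 * dx P)]"

definition average_rhs :: "sw_scheme \<Rightarrow> grid_vec \<Rightarrow> grid_vec \<Rightarrow> int \<Rightarrow> real^2" where
  "average_rhs P Ubar V j =
     - ((1 / dx P) *\<^sub>R (flux P V (j + 1) - flux P V j)) + source P Ubar V j"

subsection \<open>The semi-discrete scheme and its equilibria\<close>

text \<open>
  \<open>K\<close> is the set of cell indices: \<open>{1..N}\<close> for a mesh with \<open>N\<close> cells, a larger interval if ghost
  cells are added, \<open>UNIV\<close> for an unbounded mesh. The evolution formula for a point value needs
  the cells on both sides of the node.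
\<close>

definition inner_nodes :: "int set \<Rightarrow> int set" where
  "inner_nodes K = {j. j - 1 \<in> K \<and> j \<in> K}"

definition evolves_at ::
  "sw_scheme \<Rightarrow> int set \<Rightarrow> real set \<Rightarrow> (real \<Rightarrow> grid_vec) \<Rightarrow> (real \<Rightarrow> grid_vec) \<Rightarrow> real \<Rightarrow> bool" where
  "evolves_at P K T Ubar V t \<longleftrightarrow>
     (\<forall>j\<in>K. ((\<lambda>s. Ubar s j) has_vector_derivative average_rhs P (Ubar t) (V t) j) (at t within T)) \<and>
     (\<forall>j\<in>inner_nodes K. ((\<lambda>s. V s j) has_vector_derivative point_rhs P (Ubar t) (V t) j) (at t within T))"

definition nonneg_depth :: "int set \<Rightarrow> grid_vec \<Rightarrow> grid_vec \<Rightarrow> bool" where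
  "nonneg_depth K Ubar V \<longleftrightarrow> (\<forall>j\<in>K. 0 \<le> Ubar j $ 1 \<and> 0 \<le> V j $ 1 \<and> 0 \<le> V (j + 1) $ 1)"

definition in_equilibrium ::
  "sw_scheme \<Rightarrow> int set \<Rightarrow> grid_vec \<Rightarrow> grid_vec \<Rightarrow> real \<Rightarrow> real \<Rightarrow> bool" where
  "in_equilibrium P K Ubar V qhat Ehat \<longleftrightarrow>
     (\<forall>j\<in>K. \<forall>p\<in>{Node j, Center j, Node (j + 1)}.
        q_at Ubar V p = qhat \<and> E_at P Ubar V p = Ehat)"

text \<open>
  For moving water the desingularization must be inactive at the cell centers. Otherwise
  \<open>u\<close> is set to \<open>0\<close> there while \<open>q = qhat \<noteq> 0\<close>, the relation \<open>q = h u\<close> is lost, and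
  \<open>average_rhs\<close> need not vanish on equilibrium data.
\<close>

definition centers_regular :: "sw_scheme \<Rightarrow> int set \<Rightarrow> grid_vec \<Rightarrow> grid_vec \<Rightarrow> real \<Rightarrow> bool" where
  "centers_regular P K Ubar V qhat \<longleftrightarrow>
     (qhat \<noteq> 0 \<longrightarrow> (\<forall>j\<in>K. desing_eps P \<le> h_at Ubar V (Center j)))"

end

theory Submission
  imports Defs
begin

text \<open>
  If \<open>q\<close> and \<open>E\<close> agree at two points \<open>a, b\<close>, then \<open>\<Gamma> = 1\<close> and \<open>g[Z + Q] = - [u\<^sup>2/2 + g h]\<close>. The
  relation \<open>h\<^sub>a u\<^sub>a = h\<^sub>b u\<^sub>b\<close> then turns each source contribution into the exact jump of the momentum
  flux, so both \<open>S\<^sub>1\<close> and \<open>S\<^sub>2\<close> equal the flux difference over the cell and their Richardson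
  combination \<open>(4 S\<^sub>2 - S\<^sub>1)/3\<close> cancels it. The fluctuations at the nodes are linear in differences
  of \<open>E\<close>-vectors, which vanish.
\<close>

definition momentum_flux :: "sw_scheme \<Rightarrow> grid_vec \<Rightarrow> grid_vec \<Rightarrow> gl_point \<Rightarrow> real" where
  "momentum_flux P Ubar V p =
     h_at Ubar V p * (u_at P Ubar V p)\<^sup>2 + grav P / 2 * (h_at Ubar V p)\<^sup>2"

text \<open>
  Avoids dividing by \<open>h\<close>: since \<open>q = (h\<^sub>a u\<^sub>a + h\<^sub>b u\<^sub>b) / 2\<close>, the jump of \<open>h u\<^sup>2\<close> is
  \<open>q [u] = (h\<^sub>a + h\<^sub>b)/2 [u\<^sup>2/2] + [h] [u]\<^sup>2/4\<close>.
\<close>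

lemma S_part_equilibrium:
  assumes Ev: "Evec P Ubar V a = Evec P Ubar V b"
    and qa: "q_at Ubar V a = h_at Ubar V a * u_at P Ubar V a"
    and qb: "q_at Ubar V b = h_at Ubar V b * u_at P Ubar V b"
  shows "S_part P Ubar V a b = momentum_flux P Ubar V b - momentum_flux P Ubar V a"
proof -
  define ha hb ua ub where "ha = h_at Ubar V a" and "hb = h_at Ubar V b"
    and "ua = u_at P Ubar V a" and "ub = u_at P Ubar V b"
  define w where "w = (Z_at P b + Q_at P Ubar V b) - (Z_at P a + Q_at P Ubar V a)"
  have "q_at Ubar V a = q_at Ubar V b" and "E_at P Ubar V a = E_at P Ubar V b"
    using Ev by (simp_all add: Evec_def vec_eq_iff forall_2)
  then have mass: "ha * ua = hb * ub"
    and energy: "grav P * w = ua\<^sup>2 / 2 - ub\<^sup>2 / 2 + grav P * (ha - hb)"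
    using qa qb by (simp_all add: E_at_def ha_def hb_def ua_def ub_def w_def algebra_simps)
  \<comment> \<open>The norm in \<open>Gam\<close> is 0, and \<open>0 powr gam_m P\<close> evaluates
    to 0.\<close>
  have "Gam P Ubar V a b = 1"
    using Ev by (simp add: Gam_def)
  then have "S_part P Ubar V a b = - (ha + hb) / 2 * (grav P * w) + (hb - ha) * (ub - ua)\<^sup>2 / 4"
    by (simp add: S_part_def s_hat_def ha_def hb_def ua_def ub_def w_def field_simps)
  also have "\<dots> = (ha * ua + hb * ub) / 2 * (ub - ua) + grav P / 2 * (hb\<^sup>2 - ha\<^sup>2)"
    unfolding energy by (simp add: field_simps power2_eq_square)
  also have "\<dots> = (hb * ub) * ub - (ha * ua) * ua + grav P / 2 * (hb\<^sup>2 - ha\<^sup>2)"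
    unfolding mass by (simp add: algebra_simps)
  finally show ?thesis
    by (simp add: momentum_flux_def ha_def hb_def ua_def ub_def power2_eq_square algebra_simps)
qed

lemma q_at_Node: "q_at Ubar V (Node j) = h_at Ubar V (Node j) * u_at P Ubar V (Node j)"
  by (simp add: q_at_def h_at_def U_node_def)

text \<open>If q = 0, both branches of \<open>desing\<close> return 0; otherwise the depth is at
  least \<open>desing_eps P\<close> > 0, so multiplying the quotient by it recovers q.\<close>

lemma q_at_Center:
  assumes "0 < desing_eps P"
    and "q_at Ubar V (Center j) \<noteq> 0 \<Longrightarrow> desing_eps P \<le> h_at Ubar V (Center j)"
  shows "q_at Ubar V (Center j) = h_at Ubar V (Center j) * u_at P Ubar V (Center j)"
  using assms by (cases "q_at Ubar V (Center j) = 0") (auto simp: desing_def)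

lemma flux_eq:
  "flux P V j = vector [q_at Ubar V (Node j), momentum_flux P Ubar V (Node j)]"
  by (simp add: flux_def momentum_flux_def q_at_def h_at_def U_node_def)

lemma average_rhs_equilibrium:
  assumes "0 < dx P"
    and left: "Evec P Ubar V (Node j) = Evec P Ubar V (Center j)"
    and right: "Evec P Ubar V (Center j) = Evec P Ubar V (Node (j + 1))"
    and center: "q_at Ubar V (Center j) = h_at Ubar V (Center j) * u_at P Ubar V (Center j)"
  shows "average_rhs P Ubar V j = 0"
proof -
  let ?jump = "momentum_flux P Ubar V (Node (j + 1)) - momentum_flux P Ubar V (Node j)"
  have q: "q_at Ubar V (Node j) = q_at Ubar V (Node (j + 1))"
    using left right by (simp add: Evec_def vec_eq_iff forall_2)
  have "S1 P Ubar V j = ?jump"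
    unfolding S1_def by (intro S_part_equilibrium q_at_Node) (simp add: left right)
  \<comment> \<open>The two half-cell jumps telescope: the momentum flux at the center
    cancels.\<close>
  moreover have "S2 P Ubar V j = ?jump"
    unfolding S2_def
    by (simp only: S_part_equilibrium[OF left q_at_Node center]
        S_part_equilibrium[OF right center q_at_Node])
  ultimately have "source P Ubar V j = vector [0, ?jump / dx P]"
    using \<open>0 < dx P\<close> by (simp add: source_def diff_divide_distrib)
  then show ?thesis
    using q by (simp add: average_rhs_def flux_eq[where Ubar = Ubar] vec_eq_iff forall_2)
qed

text \<open>The weights 1, -4, 3 and -3, 4, -1 sum to 0, so both one-sided differences vanish. Any
  matrix \<open>J_tilde\<close> maps them to 0, even at a dry node, where \<open>Upsilon\<close> is
  singular.\<close>

lemma point_rhs_equilibrium: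
  assumes "Evec P Ubar V (Node (j - 1)) = e" "Evec P Ubar V (Center (j - 1)) = e"
    and "Evec P Ubar V (Node j) = e" "Evec P Ubar V (Center j) = e"
    and "Evec P Ubar V (Node (j + 1)) = e"
  shows "point_rhs P Ubar V j = 0"
proof -
  have "delta_plus P Ubar V j = 0" "delta_minus P Ubar V j = 0"
    using assms by (simp_all add: delta_plus_def delta_minus_def vec_eq_iff)
  then show ?thesis
    by (simp add: point_rhs_def Phi_left_def Phi_right_def)
qed

theorem theorem2p1:
  fixes P :: sw_scheme and K :: "int set" and T :: "real set" and t :: real
    and Ubar V :: "real \<Rightarrow> int \<Rightarrow> real^2" and qhat Ehat :: real
  assumes "valid_scheme P"
    and "nonneg_depth K (Ubar t) (V t)"
    and "in_equilibrium P K (Ubar t) (V t) qhat Ehat"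
    and "centers_regular P K (Ubar t) (V t) qhat"
  shows "(\<forall>j\<in>K. average_rhs P (Ubar t) (V t) j = 0) \<and>
         (\<forall>j\<in>inner_nodes K. point_rhs P (Ubar t) (V t) j = 0) \<and>
         (evolves_at P K T Ubar V t \<longrightarrow>
            (\<forall>j\<in>K. ((\<lambda>s. Ubar s j) has_vector_derivative 0) (at t within T)) \<and>
            (\<forall>j\<in>inner_nodes K. ((\<lambda>s. V s j) has_vector_derivative 0) (at t within T)))"
proof -
  have E: "Evec P (Ubar t) (V t) p = vector [qhat, Ehat]"
    if "j \<in> K" "p \<in> {Node j, Center j, Node (j + 1)}" for j p
    using assms(3) that by (auto simp: in_equilibrium_def Evec_def)
  have avg: "average_rhs P (Ubar t) (V t) j = 0" if "j \<in> K" for j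
  proof (rule average_rhs_equilibrium)
    show "0 < dx P"
      using assms(1) by (simp add: valid_scheme_def)
    show "q_at (Ubar t) (V t) (Center j)
        = h_at (Ubar t) (V t) (Center j) * u_at P (Ubar t) (V t) (Center j)"
      using assms that
      by (intro q_at_Center) (auto simp: valid_scheme_def in_equilibrium_def centers_regular_def)
  qed (simp_all add: E[OF that])
  have pt: "point_rhs P (Ubar t) (V t) j = 0" if "j \<in> inner_nodes K" for j
  proof -
    from that have "j - 1 \<in> K" "j \<in> K"
      by (auto simp: inner_nodes_def)
    \<comment> \<open>The stencil of node \<open>j\<close> is made up of the cells
      \<open>j - 1\<close> and \<open>j\<close>, which share that node.\<close>
    from E[OF this(1)] E[OF this(2)] show ?thesis
      by (intro point_rhs_equilibrium) simp_all
  qed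
  show ?thesis
    using avg pt by (simp add: evolves_at_def)
qed

end
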